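(* Let $D$ be a Steiner triple system on $v$ points. Then $$\gamma(D)\ \ge\ \left\lceil \frac{2v}{3}\right\rceil-1.$$
   Context: A Steiner triple system on $v$ points ($v\ge 3$) is a $(v,3,1)$-design: a collection $D$ of $3$-element subsets (blocks) of a $v$-element set $X$ of points such that every two distinct points lie together in exactly one block. The set of Steiner triple systems on $v$ points is denoted $STS(v)$. The incidence graph $G_D$ is the bipartite graph whose vertex set is the disjoint union of the points and the blocks of $D$, a point $x$ being adjacent to a block $B$ if and only if $x\in B$. A set $S$ of vertices of a graph is dominating if every vertex not in $S$ has a neighbour in $S$; the domination number of a graph is the minimum cardinality of a dominating set, and $\gamma(D)$ denotes the domination number of $G_D$. *)

theory Defs
  imports Complex_Main "Graph_Theory.Pair_Digraph"
begin

definition steiner_triple_system :: "nat \<Rightarrow> 'a set \<Rightarrow> 'a set set \<Rightarrow> bool" where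
  "steiner_triple_system v X D \<longleftrightarrow>
     v \<ge> 3 \<and> finite X \<and> card X = v \<and>
     (\<forall>B\<in>D. B \<subseteq> X \<and> card B = 3) \<and>
     (\<forall>x\<in>X. \<forall>y\<in>X. x \<noteq> y \<longrightarrow> (\<exists>!B. B \<in> D \<and> x \<in> B \<and> y \<in> B))"

(* An undirected edge is a pair of opposite arcs; see incidence_graph_pair_graph below. *)
definition incidence_graph :: "'a set \<Rightarrow> 'a set set \<Rightarrow> ('a + 'a set) pair_pre_digraph" where
  "incidence_graph X D =
     \<lparr> pverts = X <+> D,
       parcs = {(Inl x, Inr B) | x B. x \<in> X \<and> B \<in> D \<and> x \<in> B} \<union>
               {(Inr B, Inl x) | x B. x \<in> X \<and> B \<in> D \<and> x \<in> B} \<rparr>"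

(* Meant for symmetric arc sets, where out-neighbours are exactly the neighbours;
   domination_number moreover presupposes finite (pverts G), since it uses Min. *)
definition dominating_set :: "'v pair_pre_digraph \<Rightarrow> 'v set \<Rightarrow> bool" where
  "dominating_set G S \<longleftrightarrow>
     S \<subseteq> pverts G \<and> (\<forall>u\<in>pverts G - S. \<exists>w\<in>S. (u, w) \<in> parcs G)"

definition domination_number :: "'v pair_pre_digraph \<Rightarrow> nat" where
  "domination_number G = Min (card ` {S. dominating_set G S})"

definition design_domination_number :: "'a set \<Rightarrow> 'a set set \<Rightarrow> nat" where
  "design_domination_number X D = domination_number (incidence_graph X D)"

lemma incidence_graph_pair_graph:
  assumes "steiner_triple_system v X D"
  shows "pair_graph (incidence_graph X D)"
proof -
  have X: "finite X" and "D \<subseteq> Pow X"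
    using assms by (auto simp: steiner_triple_system_def)
  then have D: "finite D"
    by (meson finite_Pow_iff finite_subset)
  have "parcs (incidence_graph X D) \<subseteq> (X <+> D) \<times> (X <+> D)"
    by (auto simp: incidence_graph_def)
  then have arcs: "finite (parcs (incidence_graph X D))"
    using X D by (meson finite_Plus finite_SigmaI finite_subset)
  show ?thesis
    using X D arcs
    by unfold_locales (auto simp: incidence_graph_def symmetric_def intro!: symI)
qed

lemma domination_number_attained:
  assumes "finite (pverts G)"
  shows "\<exists>S. dominating_set G S \<and> card S = domination_number G"
proof -
  have "{S. dominating_set G S} \<subseteq> Pow (pverts G)"
    by (auto simp: dominating_set_def)
  then have "finite {S. dominating_set G S}"
    using assms by (meson finite_Pow_iff finite_subset)
  moreover have "pverts G \<in> {S. dominating_set G S}"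
    by (simp add: dominating_set_def)
  ultimately have "domination_number G \<in> card ` {S. dominating_set G S}"
    unfolding domination_number_def by (intro Min_in) auto
  then show ?thesis by auto
qed

end

theory Submission
  imports Defs
begin

text \<open>
  A dominating set of the incidence graph is a pair of a point set \<open>P\<close> and a block set \<open>T\<close>. Let
  \<open>U = X - P\<close> be the points left out and \<open>u\<close>, \<open>p\<close>, \<open>t\<close> the sizes of \<open>U\<close>, \<open>P\<close>, \<open>T\<close>. Domination
  of the points says that \<open>T\<close> covers \<open>U\<close>, whence \<open>u \<le> 3 t\<close>; domination of the blocks says that
  every block outside \<open>T\<close> meets \<open>P\<close>. By the second condition a pair of distinct points of \<open>U\<close> lies
  in a block of \<open>T\<close> or is completed to a block by a point of \<open>P\<close>. A block of \<open>T\<close> accounts for six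
  ordered pairs, and a point of \<open>P\<close> for at most \<open>u\<close>, since the blocks through it partition the
  other points into pairs. Hence \<open>u (u - 1) \<le> 6 t + p u\<close>.

  As \<open>v = u + p\<close>, the claim amounts to \<open>2 u \<le> 3 t + p + 3\<close>. If \<open>p\<close> is at least \<open>u - 3\<close>, the
  covering bound \<open>u \<le> 3 t\<close> gives it; if \<open>p\<close> is smaller, the pair-counting bound does.
\<close>

lemma steiner_block_unique:
  assumes "steiner_triple_system v X D" "B \<in> D" "C \<in> D"
    and "x \<in> B" "y \<in> B" "x \<in> C" "y \<in> C" "x \<noteq> y"
  shows "B = C"
  using assms unfolding steiner_triple_system_def by (metis subsetD)

lemma steiner_block_exists:
  assumes "steiner_triple_system v X D" "x \<in> X" "y \<in> X" "x \<noteq> y"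
  obtains B where "B \<in> D" "x \<in> B" "y \<in> B"
  using assms unfolding steiner_triple_system_def by metis

lemma steiner_block_card:
  assumes "steiner_triple_system v X D" "B \<in> D"
  shows "card B = 3" "finite B"
proof -
  show "card B = 3"
    using assms by (simp add: steiner_triple_system_def)
  then show "finite B"
    by (intro card_ge_0_finite) simp
qed

lemma steiner_finite_blocks:
  assumes "steiner_triple_system v X D"
  shows "finite D"
proof -
  have "D \<subseteq> Pow X" "finite X"
    using assms by (auto simp: steiner_triple_system_def)
  then show ?thesis
    by (meson finite_Pow_iff finite_subset)
qed

lemma dominating_set_incidence_graphD:
  assumes "dominating_set (incidence_graph X D) S"
  shows "Inl -` S \<subseteq> X" "Inr -` S \<subseteq> D"
    and "X - Inl -` S \<subseteq> \<Union>(Inr -` S)"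
    and "\<forall>B\<in>D - Inr -` S. B \<inter> Inl -` S \<noteq> {}"
proof -
  have sub: "S \<subseteq> X <+> D"
    and dom: "\<And>a. a \<in> X <+> D \<Longrightarrow> a \<notin> S \<Longrightarrow> \<exists>w\<in>S. (a, w) \<in> parcs (incidence_graph X D)"
    using assms by (auto simp: dominating_set_def incidence_graph_def)
  show "Inl -` S \<subseteq> X" "Inr -` S \<subseteq> D"
    using sub by auto
  show "X - Inl -` S \<subseteq> \<Union>(Inr -` S)"
  proof
    fix x assume "x \<in> X - Inl -` S"
    then obtain w where "w \<in> S" "(Inl x, w) \<in> parcs (incidence_graph X D)"
      using dom[of "Inl x"] by auto
    then show "x \<in> \<Union>(Inr -` S)"
      by (auto simp: incidence_graph_def)
  qed
  show "\<forall>B\<in>D - Inr -` S. B \<inter> Inl -` S \<noteq> {}"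
  proof
    fix B assume "B \<in> D - Inr -` S"
    then obtain w where "w \<in> S" "(Inr B, w) \<in> parcs (incidence_graph X D)"
      using dom[of "Inr B"] by auto
    then show "B \<inter> Inl -` S \<noteq> {}"
      by (auto simp: incidence_graph_def)
  qed
qed

lemma card_off_diagonal:
  assumes "finite A"
  shows "card {(x, y). x \<in> A \<and> y \<in> A \<and> x \<noteq> y} = card A * (card A - 1)"
proof -
  have "{(x, y). x \<in> A \<and> y \<in> A \<and> x \<noteq> y} = (SIGMA x:A. A - {x})"
    by auto
  then show ?thesis
    using assms by simp
qed

text \<open>
  Given \<open>z\<close>, the first entry \<open>x\<close> of such a pair determines the block through \<open>x\<close> and \<open>z\<close>, whose third
  point is the second entry; so projecting to the first entry is injective.
\<close>

lemma card_pairs_completed_by_point: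
  assumes sts: "steiner_triple_system v X D" and "U \<subseteq> X" "z \<notin> U"
  shows "card {(x, y). x \<in> U \<and> y \<in> U \<and> x \<noteq> y \<and> (\<exists>B\<in>D. x \<in> B \<and> y \<in> B \<and> z \<in> B)} \<le> card U"
    (is "card ?A \<le> _")
proof (rule card_inj_on_le[where f = fst])
  show "finite U"
    using assms by (meson finite_subset steiner_triple_system_def)
  show "fst ` ?A \<subseteq> U"
    by auto
  show "inj_on fst ?A"
  proof (rule inj_onI, clarsimp)
    fix x y y' B C
    assume *: "x \<in> U" "y \<in> U" "y' \<in> U" "x \<noteq> y" "x \<noteq> y'"
      "B \<in> D" "x \<in> B" "y \<in> B" "z \<in> B" "C \<in> D" "x \<in> C" "y' \<in> C" "z \<in> C"
    then have "B = C"
      using \<open>z \<notin> U\<close> steiner_block_unique[OF sts, of B C x z] by blast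
    show "y = y'"
    proof (rule ccontr)
      assume "y \<noteq> y'"
      moreover have "z \<noteq> x" "z \<noteq> y" "z \<noteq> y'"
        using *(1-3) \<open>z \<notin> U\<close> by metis+
      ultimately have "card {x, y, y', z} = 4"
        using *(4,5) by (simp add: eq_commute)
      moreover have "{x, y, y', z} \<subseteq> B"
        using *(7-9,12) \<open>B = C\<close> by simp
      moreover have "card B = 3" "finite B"
        using steiner_block_card[OF sts \<open>B \<in> D\<close>] by simp_all
      ultimately show False
        using card_mono[of B "{x, y, y', z}"] by simp
    qed
  qed
qed

lemma card_le_if_covered_by_blocks:
  assumes "steiner_triple_system v X D" "T \<subseteq> D" "U \<subseteq> \<Union>T"
  shows "card U \<le> 3 * card T"
proof -
  have T: "finite T" "\<forall>B\<in>T. card B = 3 \<and> finite B"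
    using assms(2) finite_subset[OF _ steiner_finite_blocks[OF assms(1)]]
      steiner_block_card[OF assms(1)] by auto
  then have "finite (\<Union>T)"
    by auto
  then have "card U \<le> card (\<Union>T)"
    using assms(3) card_mono by blast
  also have "\<dots> \<le> sum card T"
    by (rule card_Union_le_sum_card)
  also have "\<dots> = 3 * card T"
    using T by simp
  finally show ?thesis .
qed

text \<open>
  Two distinct points outside \<open>P\<close> span a block that is either in \<open>T\<close> or contains a point of \<open>P\<close>,
  so the ordered pairs outside \<open>P\<close> are covered by the off-diagonals of the blocks of \<open>T\<close> and the
  sets of pairs completed by a point of \<open>P\<close>.
\<close>

lemma card_pairs_outside_le:
  assumes sts: "steiner_triple_system v X D" and "P \<subseteq> X" "T \<subseteq> D"
    and meets: "\<forall>B\<in>D - T. B \<inter> P \<noteq> {}"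
  shows "card (X - P) * (card (X - P) - 1) \<le> 6 * card T + card P * card (X - P)"
proof -
  define U where "U = X - P"
  define Q where "Q = (\<lambda>B::'a set. {(x, y). x \<in> B \<and> y \<in> B \<and> x \<noteq> y})"
  define R where
    "R = (\<lambda>z. {(x, y). x \<in> U \<and> y \<in> U \<and> x \<noteq> y \<and> (\<exists>B\<in>D. x \<in> B \<and> y \<in> B \<and> z \<in> B)})"
  have fin: "finite X" "finite U" "finite P" "finite T"
    using sts finite_subset[OF \<open>P \<subseteq> X\<close>] finite_subset[OF \<open>T \<subseteq> D\<close> steiner_finite_blocks[OF sts]]
    by (simp_all add: U_def steiner_triple_system_def)
  have B3: "finite B \<and> card B = 3" if "B \<in> T" for B
    using that \<open>T \<subseteq> D\<close> steiner_block_card[OF sts] by blast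
  have finQ: "finite (Q B)" if "B \<in> T" for B
    by (rule finite_subset[of _ "B \<times> B"]) (use B3[OF that] in \<open>auto simp: Q_def\<close>)
  have finR: "finite (R z)" for z
    by (rule finite_subset[of _ "U \<times> U"]) (use fin in \<open>auto simp: R_def\<close>)
  have cover: "Q U \<subseteq> (\<Union>B\<in>T. Q B) \<union> (\<Union>z\<in>P. R z)"
  proof (clarsimp simp: Q_def)
    fix x y
    assume xy: "x \<in> U" "y \<in> U" "x \<noteq> y" and no: "\<forall>z\<in>P. (x, y) \<notin> R z"
    then obtain B where "B \<in> D" "x \<in> B" "y \<in> B"
      using steiner_block_exists[OF sts, of x y] unfolding U_def by blast
    moreover have "B \<in> T"
    proof (rule ccontr)
      assume "B \<notin> T"
      then obtain z where "z \<in> B" "z \<in> P"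
        using meets \<open>B \<in> D\<close> by auto
      with no xy \<open>B \<in> D\<close> \<open>x \<in> B\<close> \<open>y \<in> B\<close> show False
        unfolding R_def by simp
    qed
    ultimately show "\<exists>B\<in>T. x \<in> B \<and> y \<in> B"
      by auto
  qed
  have "card U * (card U - 1) = card (Q U)"
    unfolding Q_def using card_off_diagonal[OF fin(2)] by simp
  also have "\<dots> \<le> card ((\<Union>B\<in>T. Q B) \<union> (\<Union>z\<in>P. R z))"
    using cover fin finQ finR by (intro card_mono) auto
  also have "\<dots> \<le> card (\<Union>B\<in>T. Q B) + card (\<Union>z\<in>P. R z)"
    by (rule card_Un_le)
  also have "\<dots> \<le> (\<Sum>B\<in>T. card (Q B)) + (\<Sum>z\<in>P. card (R z))"
    using fin by (intro add_mono card_UN_le)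
  also have "\<dots> \<le> (\<Sum>B\<in>T. 6) + (\<Sum>z\<in>P. card U)"
  proof (intro add_mono sum_mono)
    fix B assume "B \<in> T"
    then show "card (Q B) \<le> 6"
      unfolding Q_def using B3 card_off_diagonal[of B] by simp
  next
    fix z assume "z \<in> P"
    then show "card (R z) \<le> card U"
      unfolding R_def by (intro card_pairs_completed_by_point[OF sts]) (auto simp: U_def)
  qed
  finally show ?thesis
    by (simp add: U_def)
qed

text \<open>
  With \<open>k = u - 1 - p\<close>, the first assumption reads \<open>u k \<le> 6 t\<close> and the conclusion follows from
  \<open>2 (u + k - 2) \<le> 6 t\<close>. The difference of the two lower bounds is \<open>(u - 2) (k - 2)\<close>, which is
  nonnegative as soon as \<open>k \<ge> 2\<close>, because \<open>u > k\<close>. For smaller \<open>k\<close> it is the covering bound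
  that suffices.
\<close>

lemma domination_arithmetic:
  fixes u p t :: int
  assumes pairs: "u * (u - 1) \<le> 6 * t + p * u" and cover: "u \<le> 3 * t" and "p \<ge> 0"
  shows "2 * u \<le> 3 * t + p + 3"
proof (cases "p \<ge> u - 3")
  case True
  then show ?thesis
    using cover by linarith
next
  case False
  then have "0 \<le> (u - 2) * (u - 1 - p - 2)"
    using \<open>p \<ge> 0\<close> by (intro mult_nonneg_nonneg) linarith+
  then show ?thesis
    using pairs by (simp add: algebra_simps)
qed

theorem theorem7p2:
  fixes v :: nat and X :: "'a set" and D :: "'a set set"
  assumes "steiner_triple_system v X D"
  shows "int (design_domination_number X D) \<ge> \<lceil>2 * real v / 3\<rceil> - 1"
proof -
  have X: "finite X" "card X = v"
    using assms by (auto simp: steiner_triple_system_def)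
  have "finite (pverts (incidence_graph X D))"
    using X steiner_finite_blocks[OF assms] by (simp add: incidence_graph_def)
  then obtain S where S: "dominating_set (incidence_graph X D) S"
      "card S = design_domination_number X D"
    using domination_number_attained unfolding design_domination_number_def by blast
  define P where "P = Inl -` S"
  define T where "T = Inr -` S"
  have S_eq: "S = P <+> T"
  proof (rule set_eqI)
    show "a \<in> S \<longleftrightarrow> a \<in> P <+> T" for a
      by (cases a) (auto simp: P_def T_def)
  qed
  have dom: "P \<subseteq> X" "T \<subseteq> D" "X - P \<subseteq> \<Union>T" "\<forall>B\<in>D - T. B \<inter> P \<noteq> {}"
    using dominating_set_incidence_graphD[OF S(1)] unfolding P_def T_def by simp_all
  have fin: "finite P" "finite T"
    using dom X steiner_finite_blocks[OF assms] by (auto intro: finite_subset)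
  define u where "u = card (X - P)"
  have v: "v = u + card P"
    using X dom(1) fin card_mono[of X P] by (simp add: u_def card_Diff_subset)
  have "int (u * (u - 1)) \<le> int (6 * card T + card P * u)"
    using card_pairs_outside_le[OF assms dom(1,2,4)] unfolding u_def by (intro of_nat_mono)
  moreover have "int (u * (u - 1)) = int u * (int u - 1)"
    by (cases u) (auto simp: algebra_simps)
  moreover have "u \<le> 3 * card T"
    using card_le_if_covered_by_blocks[OF assms dom(2,3)] by (simp add: u_def)
  ultimately have "2 * int u \<le> 3 * int (card T) + int (card P) + 3"
    by (intro domination_arithmetic) auto
  moreover have "design_domination_number X D = card P + card T"
    using S(2) fin by (simp add: S_eq card_Plus)
  ultimately show ?thesis
    using v by linarith
qed

end
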